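(* Let $m \in \mathbb{N}$, $m > 1$, and let $N$ be a positive integer divisible by $2m$; put $s = N/(2m)$. Construct a network on $N$ nodes as follows: (i) split the nodes into $2m$ sets $V_1,\dots,V_{2m}$ of $s$ nodes each; (ii) link every pair of nodes within each set $V_i$; (iii) partition the nodes into $s$ vertex-disjoint cycles, each containing exactly one node from each of the sets $V_1,\dots,V_{2m}$ (so each cycle has length $2m$), and include the links of these cycles. Then the resulting network is $N/(2m)$-robust and has the minimum number of links among all $N/(2m)$-robust networks on $N$ nodes.
   Context: A network is a finite simple undirected graph; links are edges. For an integer $N_f$, a network $G$ is $N_f$-robust if for every set $S$ of $N_f$ nodes of $G$, the network obtained by deleting the nodes of $S$ and their incident links is connected. *)

theory Defs
  imports "Graph_Theory.Graph_Theory" "HOL-Library.Disjoint_Sets"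
begin

text \<open>
  A network is a \<^locale>\<open>pair_graph\<close>: a finite, loop-free, symmetric digraph whose arcs are
  pairs of vertices. Each undirected link is represented by two opposite arcs, so links are
  counted as unordered pairs.
\<close>

definition links :: "'a pair_pre_digraph \<Rightarrow> 'a set set" where
  "links G = {{u, v} | u v. (u, v) \<in> parcs G}"

definition robust :: "nat \<Rightarrow> 'a pair_pre_digraph \<Rightarrow> bool" where
  "robust k G \<longleftrightarrow>
    (\<forall>S. S \<subseteq> pverts G \<and> card S = k \<longrightarrow>
      Digraph_Component.connected (with_proj G \<restriction> (pverts G - S)))"

text \<open>
  A cycle is given by the list of its vertices in cyclic order; its arcs join consecutive
  vertices, and the last vertex to the first, in both directions.
\<close>

definition cycle_arcs :: "'a list \<Rightarrow> ('a \<times> 'a) set" where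
  "cycle_arcs xs = set (zip xs (rotate1 xs)) \<union> (set (zip xs (rotate1 xs)))\<inverse>"

definition clique_arcs :: "'a set \<Rightarrow> ('a \<times> 'a) set" where
  "clique_arcs A = {(u, v). u \<in> A \<and> v \<in> A \<and> u \<noteq> v}"

definition clique_cycle_network ::
    "'a set \<Rightarrow> nat \<Rightarrow> (nat \<Rightarrow> 'a set) \<Rightarrow> nat \<Rightarrow> (nat \<Rightarrow> 'a list) \<Rightarrow> 'a pair_pre_digraph" where
  "clique_cycle_network X n V s C =
    \<lparr> pverts = X,
      parcs = (\<Union>i\<in>{1..n}. clique_arcs (V i)) \<union> (\<Union>k\<in>{1..s}. cycle_arcs (C k)) \<rparr>"

end

theory Submission
  imports Defs
begin

text \<open>
  Every node of the network has degree \<open>s + 1\<close>, and in an \<open>s\<close>-robust network no node can have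
  fewer neighbours, since deleting \<open>s\<close> nodes including all its neighbours would isolate it.

  For robustness, let \<open>S\<close> be a set of \<open>s\<close> deleted nodes. If some cycle avoids \<open>S\<close>, it meets all
  the cliques and hence joins everything that is left. Otherwise each of the \<open>s\<close> cycles loses
  exactly one node and leaves a path that meets all cliques but one; any two such paths meet a
  common clique, because there are at least three cliques.
\<close>

section \<open>Connectivity and link counts expressed through arcs\<close>

lemma connected_induce_iff:
  assumes "sym (parcs G)"
  shows "Digraph_Component.connected (with_proj G \<restriction> W) \<longleftrightarrow>
    W \<noteq> {} \<and> (\<forall>u\<in>W. \<forall>v\<in>W. (u, v) \<in> rtrancl_on W (parcs G))"
proof -
  \<comment> \<open>Connectivity is defined on the symmetric closure, which adds nothing to
    symmetric arcs. As \<open>rtrancl_on W\<close> keeps every visited node in \<open>W\<close>,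
    restricting the arcs to \<open>W\<close> does not change it either.\<close>
  have arcs: "parcs (mk_symmetric (with_proj G \<restriction> W)) = parcs G \<inter> W \<times> W"
    using assms by (auto simp: parcs_mk_symmetric dest: symD)
  have "(u, v) \<in> rtrancl_on W (parcs G \<inter> W \<times> W)" if "(u, v) \<in> rtrancl_on W (parcs G)" for u v
    using that by induct (auto intro: converse_rtrancl_on_into_rtrancl_on)
  moreover have "(u, v) \<in> rtrancl_on W (parcs G)"
    if "(u, v) \<in> rtrancl_on W (parcs G \<inter> W \<times> W)" for u v
    using that by (rule rtrancl_on_mono[rotated 2]) auto
  ultimately show ?thesis
    by (auto simp: connected_def strongly_connected_def reachable_def arcs)
qed

lemma pair_graph_sym:
  assumes "pair_graph G"
  shows "sym (parcs G)"
proof -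
  interpret pair_graph G by fact
  show ?thesis using pair_sym_arcs by (simp add: symmetric_def)
qed

text \<open>Double counting: without loops, the two orientations of a link are distinct arcs, so
  forgetting orientation is exactly two-to-one.\<close>

lemma card_links:
  assumes "pair_graph G"
  shows "2 * card (links G) = card (parcs G)"
proof -
  interpret pair_graph G by fact
  let ?f = "\<lambda>(u, v). {u, v}"
  have links: "links G = ?f ` parcs G"
    by (auto simp: links_def)
  have fibre: "card {p \<in> parcs G. ?f p = e} = 2" if "e \<in> links G" for e
  proof -
    obtain u v where uv: "(u, v) \<in> parcs G" "e = {u, v}"
      using \<open>e \<in> links G\<close> by (auto simp: links_def)
    then have "(v, u) \<in> parcs G" "u \<noteq> v"
      using pair_graph_sym[OF assms] pair_no_loops[OF uv(1)] by (auto dest: symD)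
    then have "{p \<in> parcs G. ?f p = e} = {(u, v), (v, u)}"
      using uv by (auto simp: doubleton_eq_iff)
    with \<open>u \<noteq> v\<close> show ?thesis by simp
  qed
  have "card (parcs G) = (\<Sum>e\<in>links G. card {p \<in> parcs G. ?f p = e})"
    using sum.image_gen[OF pair_finite_arcs, of "\<lambda>_. 1::nat" ?f] by (simp add: links)
  then show ?thesis by (simp add: fibre)
qed

section \<open>Lower bound: degrees and arcs of a robust network\<close>

lemma robust_degree_gt:
  assumes "pair_graph G" "robust s G" "v \<in> pverts G" "s + 1 < card (pverts G)"
  shows "s < card (parcs G `` {v})"
proof (rule ccontr)
  interpret pair_graph G by fact
  let ?A = "parcs G `` {v}"
  assume "\<not> s < card ?A"
  moreover have "?A \<subseteq> pverts G - {v}"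
    using pair_no_loops in_arcsD2 by fastforce
  moreover have "s \<le> card (pverts G - {v})"
    using assms pair_finite_verts by simp
  \<comment> \<open>Robustness speaks of exactly \<open>s\<close> deleted nodes, so the
    neighbourhood of \<open>v\<close> is padded to size \<open>s\<close> without touching
    \<open>v\<close>.\<close>
  ultimately obtain S where S: "?A \<subseteq> S" "S \<subseteq> pverts G - {v}" "card S = s"
    using exists_subset_between[of ?A s "pverts G - {v}"] pair_finite_verts by auto
  let ?W = "pverts G - S"
  have "card ?W = card (pverts G) - s"
    using S pair_finite_verts by (metis Diff_subset card_Diff_subset finite_subset subset_trans)
  \<comment> \<open>More than \<open>s + 1\<close> nodes in total leave a survivor besides
    \<open>v\<close>.\<close>
  then have "\<not> ?W \<subseteq> {v}"
    using assms(4) card_mono[of "{v}" ?W] by auto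
  then obtain w where w: "w \<in> ?W" "w \<noteq> v" by blast
  have "(v, w) \<in> rtrancl_on ?W (parcs G)"
    using assms(2,3) S w connected_induce_iff[OF pair_graph_sym[OF assms(1)], of ?W]
    unfolding robust_def by blast
  \<comment> \<open>The first arc of a walk from \<open>v\<close> to \<open>w\<close> would end in a
    surviving neighbour of \<open>v\<close>, but all neighbours lie in \<open>S\<close>.\<close>
  then show False
  proof (cases rule: converse_rtrancl_on_cases)
    case (step c)
    then show False using S(1) in_rtrancl_on_in_F(1)[OF step(2)] by blast
  qed (use w in simp)
qed

lemma robust_card_parcs_ge:
  assumes "pair_graph G" "robust s G" "s + 1 < card (pverts G)"
  shows "card (pverts G) * (s + 1) \<le> card (parcs G)"
proof -
  interpret pair_graph G by fact
  have "parcs G = (SIGMA v:pverts G. parcs G `` {v})"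
    using in_arcsD1 by auto
  moreover have "finite (parcs G `` {v})" for v
    by (rule finite_Image[OF pair_finite_arcs])
  ultimately have "card (parcs G) = (\<Sum>v\<in>pverts G. card (parcs G `` {v}))"
    using card_SigmaI[OF pair_finite_verts] by metis
  moreover have "(\<Sum>v\<in>pverts G. s + 1) \<le> (\<Sum>v\<in>pverts G. card (parcs G `` {v}))"
    using robust_degree_gt[OF assms(1,2) _ assms(3)] by (intro sum_mono) (simp add: Suc_le_eq)
  ultimately show ?thesis by simp
qed

section \<open>Walks along paths and cycles given as lists\<close>

lemma path_rtrancl_on:
  assumes "sym r" "set xs \<subseteq> F" "set (zip xs (tl xs)) \<subseteq> r" "u \<in> set xs" "v \<in> set xs"
  shows "(u, v) \<in> rtrancl_on F r"
proof -
  have sym: "sym (rtrancl_on F r)" by (rule rtrancl_on_sym[OF assms(1)])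
  \<comment> \<open>It suffices to reach every entry from the head: by symmetry, two such walks
    combine into one between any two entries.\<close>
  have "(hd xs, w) \<in> rtrancl_on F r" if "w \<in> set xs" for w
    using assms(2,3) that
  proof (induction xs)
    case (Cons x xs)
    show ?case
    proof (cases "w = x")
      case True
      then show ?thesis using Cons.prems by auto
    next
      case False
      then obtain y ys where "xs = y # ys" "w \<in> set xs"
        using Cons.prems by (cases xs) auto
      then show ?thesis
        using Cons by (auto intro: converse_rtrancl_on_into_rtrancl_on)
    qed
  qed simp
  then show ?thesis
    using assms(4,5) sym by (blast dest: symD intro: rtrancl_on_trans)
qed

lemma zip_rotate1:
  assumes "length xs = length ys"
  shows "zip (rotate1 xs) (rotate1 ys) = rotate1 (zip xs ys)"
  using assms by (cases xs; cases ys) auto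

lemma cycle_arcs_rotate1: "cycle_arcs (rotate1 xs) = cycle_arcs xs"
  by (simp add: cycle_arcs_def zip_rotate1)

lemma cycle_arcs_rotate: "cycle_arcs (rotate n xs) = cycle_arcs xs"
  by (induction n) (auto simp: cycle_arcs_rotate1)

lemma zip_tl_subset_cycle_arcs: "set (zip xs (tl xs)) \<subseteq> cycle_arcs xs"
proof (cases xs)
  case (Cons x ys)
  \<comment> \<open>\<open>zip\<close> stops at the shorter list, so cutting the last entry off
    \<open>x # ys\<close> isolates the pair that closes the cycle.\<close>
  have "zip (x # ys) (ys @ [x]) = zip (x # ys) ys @ [(last (x # ys), x)]"
    using zip_append[of "butlast (x # ys)" ys "[last (x # ys)]" "[x]"]
      zip_append1[of "butlast (x # ys)" "[last (x # ys)]" ys]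
    by (simp del: butlast.simps last.simps)
  then have "set (zip (x # ys) ys) \<subseteq> set (zip (x # ys) (ys @ [x]))"
    by auto
  then show ?thesis by (auto simp: Cons cycle_arcs_def)
qed simp

text \<open>Rotating the cycle so that \<open>a\<close> comes first and then dropping the head
  leaves a path through all other nodes. If \<open>a\<close> is not on the cycle, the list itself is
  such a path.\<close>

lemma cycle_diff_rtrancl_on:
  assumes "sym r" "cycle_arcs xs \<subseteq> r" "distinct xs" "set xs - {a} \<subseteq> F"
    "u \<in> set xs - {a}" "v \<in> set xs - {a}"
  shows "(u, v) \<in> rtrancl_on F r"
proof (cases "a \<in> set xs")
  case True
  then obtain us vs where xs: "xs = us @ a # vs"
    by (auto dest: split_list)
  have "rotate (length us) xs = a # vs @ us"
    using rotate_append[of us "a # vs"] by (simp add: xs)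
  then have "set (zip (a # vs @ us) (vs @ us)) \<subseteq> r"
    using zip_tl_subset_cycle_arcs[of "a # vs @ us"] cycle_arcs_rotate[of "length us" xs] assms(2)
    by simp
  moreover have "set (zip ys (tl ys)) \<subseteq> set (zip (a # ys) ys)" for ys
    by (cases ys) auto
  ultimately have "set (zip (vs @ us) (tl (vs @ us))) \<subseteq> r"
    by blast
  moreover have "set (vs @ us) = set xs - {a}"
    using assms(3) by (auto simp: xs)
  ultimately show ?thesis
    using path_rtrancl_on[OF assms(1), of "vs @ us" F] assms(4-6) by simp
next
  case False
  then show ?thesis
    using path_rtrancl_on[OF assms(1), of xs F] zip_tl_subset_cycle_arcs[of xs] assms by auto
qed

lemma cycle_arcs_subset: "cycle_arcs xs \<subseteq> set xs \<times> set xs"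
  by (auto simp: cycle_arcs_def dest: set_zip_leftD set_zip_rightD)

lemma cycle_arcs_irrefl:
  assumes "distinct xs" "length xs \<ge> 2" "(u, v) \<in> cycle_arcs xs"
  shows "u \<noteq> v"
proof -
  have "xs ! i \<noteq> rotate1 xs ! i" if "i < length xs" for i
  proof -
    \<comment> \<open>The last index wraps around to 0, which differs from it because the length is
      at least 2.\<close>
    have "Suc i mod length xs \<noteq> i"
      using that assms(2) by (cases "Suc i = length xs") auto
    then show ?thesis
      using that assms(1) by (metis nth_rotate1 nth_eq_iff_index_eq mod_less_divisor not_less_zero
          gr_zeroI)
  qed
  then show ?thesis
    using assms(3) by (auto simp: cycle_arcs_def set_zip)
qed

lemma card_cycle_arcs_le: "card (cycle_arcs xs) \<le> 2 * length xs"
proof -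
  let ?Z = "set (zip xs (rotate1 xs))"
  have "card ?Z \<le> length xs"
    using card_length[of "zip xs (rotate1 xs)"] by simp
  moreover have "card (cycle_arcs xs) \<le> card ?Z + card (?Z\<inverse>)"
    unfolding cycle_arcs_def by (rule card_Un_le)
  ultimately show ?thesis by simp
qed

lemma card_clique_arcs:
  assumes "finite A"
  shows "card (clique_arcs A) = card A * (card A - 1)"
proof -
  have "clique_arcs A = (SIGMA u:A. A - {u})"
    by (auto simp: clique_arcs_def)
  then show ?thesis using assms by simp
qed

section \<open>The network of cliques and cycles: its size and number of arcs\<close>

locale clique_cycle =
  fixes n s :: nat and X :: "'a set" and V :: "nat \<Rightarrow> 'a set" and C :: "nat \<Rightarrow> 'a list"
  assumes n: "n \<ge> 3" and s: "s > 0" and fin: "finite X"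
    and V_disj: "disjoint_family_on V {1..n}" and V_Un: "(\<Union>i\<in>{1..n}. V i) = X"
    and card_V: "\<And>i. i \<in> {1..n} \<Longrightarrow> card (V i) = s"
    and C_disj: "disjoint_family_on (\<lambda>k. set (C k)) {1..s}"
    and C_Un: "(\<Union>k\<in>{1..s}. set (C k)) = X"
    and dist: "\<And>k. k \<in> {1..s} \<Longrightarrow> distinct (C k)"
    and meet: "\<And>k i. k \<in> {1..s} \<Longrightarrow> i \<in> {1..n} \<Longrightarrow> \<exists>!v. v \<in> set (C k) \<and> v \<in> V i"
begin

abbreviation "G \<equiv> clique_cycle_network X n V s C"

lemma pverts_G [simp]: "pverts G = X"
  by (simp add: clique_cycle_network_def)

lemma parcs_G: "parcs G = (\<Union>i\<in>{1..n}. clique_arcs (V i)) \<union> (\<Union>k\<in>{1..s}. cycle_arcs (C k))"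
  by (simp add: clique_cycle_network_def)

lemma finite_V: "i \<in> {1..n} \<Longrightarrow> finite (V i)"
  using V_Un fin by (metis UN_upper finite_subset)

lemma card_X: "card X = n * s"
proof -
  have "card (\<Union>i\<in>{1..n}. V i) = (\<Sum>i\<in>{1..n}. card (V i))"
    using V_disj by (rule card_UN_disjoint') (auto intro: finite_V)
  also have "\<dots> = (\<Sum>i\<in>{1..n}. s)"
    using card_V by (rule sum.cong[OF refl])
  finally show ?thesis unfolding V_Un by simp
qed

text \<open>The cliques cut the cycle into \<open>n\<close> disjoint singletons.\<close>

lemma length_C:
  assumes "k \<in> {1..s}"
  shows "length (C k) = n"
proof -
  have "disjoint_family_on (\<lambda>i. set (C k) \<inter> V i) {1..n}"
    using V_disj unfolding disjoint_family_on_def by blast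
  then have "card (\<Union>i\<in>{1..n}. set (C k) \<inter> V i) = (\<Sum>i\<in>{1..n}. card (set (C k) \<inter> V i))"
    by (intro card_UN_disjoint') auto
  also have "\<dots> = (\<Sum>i\<in>{1..n}. 1)"
  proof (rule sum.cong)
    fix i assume "i \<in> {1..n}"
    then obtain v where "set (C k) \<inter> V i = {v}"
      using meet[OF assms] by blast
    then show "card (set (C k) \<inter> V i) = 1" by simp
  qed simp
  also have "(\<Union>i\<in>{1..n}. set (C k) \<inter> V i) = set (C k)"
    using V_Un C_Un assms by blast
  finally show ?thesis
    using dist[OF assms] by (simp add: distinct_card)
qed

lemma sym_parcs_G: "sym (parcs G)"
  unfolding parcs_G by (auto intro!: symI simp: clique_arcs_def cycle_arcs_def)

lemma parcs_G_subset: "parcs G \<subseteq> X \<times> X"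
proof -
  have "clique_arcs (V i) \<subseteq> X \<times> X" if "i \<in> {1..n}" for i
    using V_Un that by (auto simp: clique_arcs_def)
  moreover have "cycle_arcs (C k) \<subseteq> X \<times> X" if "k \<in> {1..s}" for k
    using C_Un that cycle_arcs_subset[of "C k"] by blast
  ultimately show ?thesis unfolding parcs_G by blast
qed

lemma pair_graph_G: "pair_graph G"
proof
  fix e assume e: "e \<in> parcs G"
  then show "fst e \<in> pverts G" "snd e \<in> pverts G"
    using parcs_G_subset by auto
  show "fst e \<noteq> snd e"
  proof (cases "\<exists>k\<in>{1..s}. e \<in> cycle_arcs (C k)")
    case True
    then obtain k where "k \<in> {1..s}" "(fst e, snd e) \<in> cycle_arcs (C k)" by auto
    then show ?thesis using cycle_arcs_irrefl[OF dist] length_C n by simp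
  next
    case False
    then show ?thesis using e unfolding parcs_G by (auto simp: clique_arcs_def)
  qed
next
  show "finite (pverts G)" using fin by simp
  show "finite (parcs G)" using fin parcs_G_subset by (meson finite_SigmaI finite_subset)
  show "symmetric (with_proj G)" using sym_parcs_G by (simp add: symmetric_def)
qed

text \<open>Each of the \<open>n * s\<close> nodes contributes at most \<open>s - 1\<close> clique
  arcs and two cycle arcs. Union bounds suffice, since any overlap only lowers the count.\<close>

lemma card_parcs_G_le: "card (parcs G) \<le> n * s * (s + 1)"
proof -
  have "card (\<Union>i\<in>{1..n}. clique_arcs (V i)) \<le> (\<Sum>i\<in>{1..n}. card (clique_arcs (V i)))"
    by (rule card_UN_le) simp
  also have "\<dots> = (\<Sum>i\<in>{1..n}. s * (s - 1))"
    by (rule sum.cong) (auto simp: card_clique_arcs finite_V card_V)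
  finally have cliques: "card (\<Union>i\<in>{1..n}. clique_arcs (V i)) \<le> n * (s * (s - 1))"
    by simp
  have "card (\<Union>k\<in>{1..s}. cycle_arcs (C k)) \<le> (\<Sum>k\<in>{1..s}. card (cycle_arcs (C k)))"
    by (rule card_UN_le) simp
  also have "\<dots> \<le> (\<Sum>k\<in>{1..s}. 2 * n)"
  proof (rule sum_mono)
    show "card (cycle_arcs (C k)) \<le> 2 * n" if "k \<in> {1..s}" for k
      using card_cycle_arcs_le[of "C k"] length_C[OF that] by simp
  qed
  finally have "card (\<Union>k\<in>{1..s}. cycle_arcs (C k)) \<le> 2 * n * s"
    by (simp add: mult.commute)
  with cliques have "card (parcs G) \<le> n * (s * (s - 1)) + 2 * n * s"
    unfolding parcs_G by (meson add_mono card_Un_le le_trans)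
  also have "\<dots> = n * s * (s + 1)"
    using s by (cases s) (auto simp: algebra_simps)
  finally show ?thesis .
qed

section \<open>Robustness of the construction\<close>

lemma robust_G: "robust s G"
  unfolding robust_def connected_induce_iff[OF sym_parcs_G] pverts_G
proof (intro allI impI conjI ballI)
  fix S assume "S \<subseteq> X \<and> card S = s"
  then have SX: "S \<subseteq> X" and card_S: "card S = s" by auto
  have finS: "finite S" using SX fin by (rule finite_subset)
  have "s < card X" using n s by (simp add: card_X)
  then show "X - S \<noteq> {}" using SX card_S by auto
  let ?R = "rtrancl_on (X - S) (parcs G)"
  have trans: "(a, c) \<in> ?R" if "(a, b) \<in> ?R" "(b, c) \<in> ?R" for a b c
    using that by (rule rtrancl_on_trans)
  have clique: "(a, b) \<in> ?R" if "i \<in> {1..n}" "a \<in> V i - S" "b \<in> V i - S" for i a b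
  proof (cases "a = b")
    case False
    then have "(a, b) \<in> parcs G" using that by (auto simp: parcs_G clique_arcs_def)
    moreover have "a \<in> X - S" "b \<in> X - S" using that V_Un by auto
    ultimately show ?thesis by (meson rtrancl_on_into_rtrancl_on rtrancl_on_refl)
  qed (use that V_Un in auto)
  \<comment> \<open>The inclusion in \<open>{c}\<close> lets one fact serve both cases: a cycle that
    loses exactly \<open>c\<close>, and an intact cycle with \<open>c\<close> any deleted
    node.\<close>
  have cycle: "(a, b) \<in> ?R"
    if "k \<in> {1..s}" "S \<inter> set (C k) \<subseteq> {c}" "c \<in> S" "a \<in> set (C k) - S" "b \<in> set (C k) - S"
    for k a b c
  proof (rule cycle_diff_rtrancl_on[OF sym_parcs_G])
    show "cycle_arcs (C k) \<subseteq> parcs G" using that(1) unfolding parcs_G by blast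
    show "set (C k) - {c} \<subseteq> X - S" using that(1,2) C_Un by blast
  qed (use that dist in auto)
  fix u v assume u: "u \<in> X - S" and v: "v \<in> X - S"
  show "(u, v) \<in> ?R"
  proof (cases "\<exists>k\<in>{1..s}. S \<inter> set (C k) = {}")
    case True
    then obtain k where k: "k \<in> {1..s}" "S \<inter> set (C k) = {}" by blast
    obtain c where c: "c \<in> S" using card_S s by fastforce
    \<comment> \<open>The walk goes from \<open>u\<close> inside its clique to the intact cycle at
      \<open>x\<close>, along the cycle to \<open>y\<close>, and inside the clique of
      \<open>v\<close> to \<open>v\<close>.\<close>
    obtain i j where ij: "i \<in> {1..n}" "u \<in> V i" "j \<in> {1..n}" "v \<in> V j"
      using u v V_Un by blast
    obtain x y where xy: "x \<in> set (C k)" "x \<in> V i" "y \<in> set (C k)" "y \<in> V j"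
      using meet[OF k(1)] ij by meson
    have "(u, x) \<in> ?R" "(y, v) \<in> ?R"
      using clique ij xy k(2) u v by blast+
    moreover have "(x, y) \<in> ?R"
      using cycle[OF k(1) _ c] xy k(2) by blast
    ultimately show ?thesis by (blast intro: trans)
  next
    case False
    \<comment> \<open>Pigeonhole: the \<open>s\<close> disjoint cycles share the \<open>s\<close>
      nodes of \<open>S\<close> and each gets at least one, so a second node on some cycle would
      push the total above \<open>s\<close>.\<close>
    have single: "card (S \<inter> set (C k)) = 1" if "k \<in> {1..s}" for k
    proof (rule ccontr)
      assume neq: "card (S \<inter> set (C k)) \<noteq> 1"
      have pos: "1 \<le> card (S \<inter> set (C l))" if "l \<in> {1..s}" for l
        using that False finS by (simp add: Suc_le_eq card_gt_0_iff)
      have "(\<Sum>l\<in>{1..s}. 1) < (\<Sum>l\<in>{1..s}. card (S \<inter> set (C l)))"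
        by (rule sum_strict_mono_ex1) (use pos neq that in \<open>force+\<close>)
      also have "\<dots> = card (\<Union>l\<in>{1..s}. S \<inter> set (C l))"
      proof (rule card_UN_disjoint'[symmetric])
        show "disjoint_family_on (\<lambda>l. S \<inter> set (C l)) {1..s}"
          using C_disj unfolding disjoint_family_on_def by blast
      qed auto
      also have "(\<Union>l\<in>{1..s}. S \<inter> set (C l)) = S"
        using C_Un SX by blast
      finally show False using card_S by simp
    qed
    obtain k l where kl: "k \<in> {1..s}" "u \<in> set (C k)" "l \<in> {1..s}" "v \<in> set (C l)"
      using u v C_Un by blast
    obtain c d where cd: "S \<inter> set (C k) = {c}" "S \<inter> set (C l) = {d}"
      using single kl by (meson card_1_singletonE)
    then obtain i j where ij: "c \<in> V i" "d \<in> V j" "i \<in> {1..n}" "j \<in> {1..n}"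
      using SX V_Un by blast
    \<comment> \<open>With at least three cliques, some \<open>V p\<close> contains neither of the
      deleted nodes \<open>c\<close> and \<open>d\<close>.\<close>
    have "card {i, j} < card {1..n}"
      using n by (cases "i = j") simp_all
    then have "\<not> {1..n} \<subseteq> {i, j}"
      using card_mono[of "{i, j}" "{1..n}"] by auto
    then obtain p where p: "p \<in> {1..n}" "p \<noteq> i" "p \<noteq> j" by blast
    obtain x y where xy: "x \<in> set (C k)" "x \<in> V p" "y \<in> set (C l)" "y \<in> V p"
      using meet p(1) kl by meson
    \<comment> \<open>The nodes where the two cycles cross \<open>V p\<close> therefore survive, and
      the walk runs along \<open>C k\<close> to \<open>x\<close>, across \<open>V p\<close> to
      \<open>y\<close>, and along \<open>C l\<close> to \<open>v\<close>.\<close>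
    have "V p \<inter> V i = {}" "V p \<inter> V j = {}"
      using V_disj p ij unfolding disjoint_family_on_def by blast+
    then have "x \<noteq> c" "y \<noteq> d" using xy(2,4) ij(1,2) by auto
    then have "x \<notin> S" "y \<notin> S" using xy(1,3) cd by auto
    have "c \<in> S" "d \<in> S" using cd by auto
    have "(u, x) \<in> ?R"
      by (rule cycle[OF kl(1) _ \<open>c \<in> S\<close>]) (use cd kl u xy \<open>x \<notin> S\<close> in simp_all)
    moreover have "(x, y) \<in> ?R"
      by (rule clique[OF p(1)]) (use xy \<open>x \<notin> S\<close> \<open>y \<notin> S\<close> in simp_all)
    moreover have "(y, v) \<in> ?R"
      by (rule cycle[OF kl(3) _ \<open>d \<in> S\<close>]) (use cd kl v xy \<open>y \<notin> S\<close> in simp_all)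
    ultimately show ?thesis by (blast intro: trans)
  qed
qed

section \<open>Minimality: the upper and lower bounds meet at \<open>n * s * (s + 1)\<close>
  arcs\<close>

lemma card_links_G_le:
  assumes "pair_graph H" "robust s H" "card (pverts H) = card X"
  shows "card (links G) \<le> card (links H)"
proof -
  \<comment> \<open>With \<open>s > 0\<close>, this gives the \<open>s + 2\<close> nodes that the
    degree bound requires.\<close>
  have "3 * s \<le> n * s" using n by (rule mult_right_mono) simp
  then have "s + 1 < card (pverts H)"
    using s assms(3) card_X by linarith
  then have "card X * (s + 1) \<le> card (parcs H)"
    using robust_card_parcs_ge[OF assms(1,2)] assms(3) by simp
  then have "card (parcs G) \<le> card (parcs H)"
    using card_parcs_G_le by (simp add: card_X)
  then show ?thesis
    using card_links[OF assms(1)] card_links[OF pair_graph_G] by simp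
qed

end

theorem theorem4:
  fixes m N s :: nat
    and X :: "'a set" and V :: "nat \<Rightarrow> 'a set" and C :: "nat \<Rightarrow> 'a list"
    and G :: "'a pair_pre_digraph"
  assumes "m > 1" and "N > 0" and "2 * m dvd N" and "s = N div (2 * m)"
    and "finite X" and "card X = N"
    and "disjoint_family_on V {1..2 * m}" and "(\<Union>i\<in>{1..2 * m}. V i) = X"
    and "\<forall>i\<in>{1..2 * m}. card (V i) = s"
    and "disjoint_family_on (\<lambda>k. set (C k)) {1..s}" and "(\<Union>k\<in>{1..s}. set (C k)) = X"
    and "\<forall>k\<in>{1..s}. distinct (C k) \<and> (\<forall>i\<in>{1..2 * m}. \<exists>!v. v \<in> set (C k) \<and> v \<in> V i)"
    and "G = clique_cycle_network X (2 * m) V s C"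
  shows "pair_graph G \<and> card (pverts G) = N \<and> robust s G \<and>
    (\<forall>H :: 'b pair_pre_digraph. pair_graph H \<and> card (pverts H) = N \<and> robust s H \<longrightarrow>
      card (links G) \<le> card (links H))"
proof -
  have "s > 0"
    using assms(1-4) by (auto elim!: dvdE)
  \<comment> \<open>Here \<open>n\<close> becomes \<open>2 * m\<close>, and \<open>m > 1\<close>
    secures the three cliques used for robustness.\<close>
  then interpret clique_cycle "2 * m" s X V C
    using assms by unfold_locales auto
  show ?thesis
    using pair_graph_G robust_G card_links_G_le \<open>card X = N\<close> by (auto simp: assms(13))
qed

end
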